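(* For all sufficiently large $k$, $\#\mathrm{ndetBstates}^3_2(k)\ge k^{2.5}$.
   Context: $T^3_2$ is the balanced rooted binary tree with 3 levels (7 nodes). An instance with parameter $k$ assigns to each of the 3 internal nodes $i$ a function $f_i:[k]^2\to[k]$ (given by its $k^2$ values) and to each of the 4 leaves an element of $[k]=\{1,\dots,k\}$; $v_i$ is the leaf label for a leaf and $v_i=f_i(\text{values of its two children})$ otherwise. $BT^3_2(k)$: decide whether the root value is $1$; its $k$-ary input variables are $f_i(a,b)$ and one per leaf. A nondeterministic $k$-way branching program computing $g:[k]^m\to R$ is a directed rooted multigraph of states, edges labelled by elements of $[k]$, nonfinal states labelled by variable indices, $|R|$ final sink states labelled by elements of $R$; on input $x$, edges labelled $x_j$ out of states labelled $j$ are activated; each computation (path of activated edges from the root) is infinite, ends in the final state labelled $g(x)$, or aborts at a state labelled $j$ with no outedge labelled $x_j$, and at least one ends in a final state. $\#\mathrm{ndetBstates}^3_2(k)$ is the minimum number of states of such a program solving $BT^3_2(k)$. *)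

theory Defs
  imports Complex_Main "HOL-Library.FuncSet" "HOL-Library.Multiset"
begin

text \<open>
  Nondeterministic \<open>k\<close>-way branching programs. The input variables are indexed by a set \<open>V\<close>
  (of size \<open>m\<close>) instead of \<open>{1..m}\<close>, so an input in \<open>[k]^m\<close> is an element of
  \<open>V \<rightarrow>\<^sub>E {1..k}\<close>. \<open>final P r\<close> is the final state labelled \<open>r\<close>; the field \<open>query\<close> gives the
  variable labelling a nonfinal state and is irrelevant elsewhere. An edge \<open>(p, a, q)\<close> leads
  from \<open>p\<close> to \<open>q\<close> and has label \<open>a\<close>.
\<close>

record ('q, 'v, 'r) nbp =
  states :: "'q set"
  start :: 'q
  query :: "'q \<Rightarrow> 'v"
  final :: "'r \<Rightarrow> 'q"
  edges :: "('q \<times> nat \<times> 'q) multiset"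

definition nbp_wf :: "nat \<Rightarrow> 'v set \<Rightarrow> 'r set \<Rightarrow> ('q, 'v, 'r) nbp \<Rightarrow> bool" where
  "nbp_wf k V R P \<longleftrightarrow>
     finite (states P) \<and> start P \<in> states P \<and>
     inj_on (final P) R \<and> final P ` R \<subseteq> states P \<and>
     (\<forall>q \<in> states P - final P ` R. query P q \<in> V) \<and>
     (\<forall>(p, a, q) \<in> set_mset (edges P). p \<in> states P - final P ` R \<and> a \<in> {1..k} \<and> q \<in> states P)"

definition activated :: "('q, 'v, 'r) nbp \<Rightarrow> ('v \<Rightarrow> nat) \<Rightarrow> 'q \<Rightarrow> 'q \<Rightarrow> bool" where
  "activated P x p q \<longleftrightarrow> (p, x (query P p), q) \<in># edges P"

text \<open>
  The finite computations, given by the sequence of visited states: paths of activated edges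
  from the root that cannot be extended. States may be repeated. A program is not restricted
  in its infinite computations, so these need no definition.
\<close>

definition finite_computation :: "('q, 'v, 'r) nbp \<Rightarrow> ('v \<Rightarrow> nat) \<Rightarrow> 'q list \<Rightarrow> bool" where
  "finite_computation P x c \<longleftrightarrow>
     c \<noteq> [] \<and> hd c = start P \<and> successively (activated P x) c \<and>
     \<not> (\<exists>q. activated P x (last c) q)"

text \<open>The computation has got stuck at a nonfinal state.\<close>

definition aborts :: "'r set \<Rightarrow> ('q, 'v, 'r) nbp \<Rightarrow> ('v \<Rightarrow> nat) \<Rightarrow> 'q list \<Rightarrow> bool" where
  "aborts R P x c \<longleftrightarrow>
     last c \<notin> final P ` R \<and> \<not> (\<exists>q. (last c, x (query P (last c)), q) \<in># edges P)"

definition nbp_computes ::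
  "nat \<Rightarrow> 'v set \<Rightarrow> 'r set \<Rightarrow> (('v \<Rightarrow> nat) \<Rightarrow> 'r) \<Rightarrow> ('q, 'v, 'r) nbp \<Rightarrow> bool" where
  "nbp_computes k V R g P \<longleftrightarrow>
     nbp_wf k V R P \<and>
     (\<forall>x \<in> V \<rightarrow>\<^sub>E {1..k}.
        (\<forall>c. finite_computation P x c \<longrightarrow> last c = final P (g x) \<or> aborts R P x c) \<and>
        (\<exists>c. finite_computation P x c \<and> last c \<in> final P ` R))"

text \<open>
  The nodes of the balanced binary tree with 3 levels are numbered as in a heap: \<open>1\<close> is the
  root, the children of \<open>i\<close> are \<open>2 * i\<close> and \<open>2 * i + 1\<close>, and the leaves are \<open>4, \<dots>, 7\<close>. The input
  variable \<open>Fn i a b\<close> stands for the value \<open>f\<^sub>i(a, b)\<close>.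
\<close>

datatype bt_var = Fn nat nat nat | Leaf nat

definition bt_vars :: "nat \<Rightarrow> bt_var set" where
  "bt_vars k = {Fn i a b | i a b. i \<in> {1..3} \<and> a \<in> {1..k} \<and> b \<in> {1..k}} \<union> Leaf ` {4..7}"

function node_value :: "(bt_var \<Rightarrow> nat) \<Rightarrow> nat \<Rightarrow> nat" where
  "node_value x i =
     (if i \<in> {1..3} then x (Fn i (node_value x (2 * i)) (node_value x (2 * i + 1)))
      else x (Leaf i))"
  by auto
termination by (relation "measure (\<lambda>(x, i). 4 - i)") auto

declare node_value.simps [simp del]

definition BT :: "(bt_var \<Rightarrow> nat) \<Rightarrow> bool" where
  "BT x \<longleftrightarrow> node_value x 1 = 1"

text \<open>
  The minimum is taken over programs whose states are natural numbers; since state sets are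
  finite, every program is isomorphic to one of these. The decision problem is
  solved by computing its characteristic function, so there are two final states.
\<close>

definition ndetBstates :: "nat \<Rightarrow> nat" where
  "ndetBstates k =
     (LEAST n. \<exists>P :: (nat, bt_var, bool) nbp.
        nbp_computes k (bt_vars k) UNIV BT P \<and> card (states P) = n)"

end

theory Submission
  imports Defs "HOL-Library.Countable"
begin

text \<open>
  Neciporuk's method. Fix \<open>a, b\<close>, label the leaves \<open>a, b, a, b\<close> and let only \<open>f\<^sub>2(a, b)\<close>,
  \<open>f\<^sub>3(a, b)\<close> and the set \<open>F \<subseteq> [k]\<^sup>2\<close> on which \<open>f\<^sub>1\<close> is \<open>1\<close> vary. Let \<open>X\<close> and \<open>Y\<close> be the
  sets of states that query \<open>f\<^sub>2(a, b)\<close> and \<open>f\<^sub>3(a, b)\<close>. An accepting path decomposes into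
  a segment from the root, segments that leave \<open>X\<close> and avoid leaving \<open>Y\<close>, and segments that leave
  \<open>Y\<close> and avoid leaving \<open>X\<close>; the existence of a segment of one of these types depends, besides \<open>F\<close>,
  on at most one of the two queried values. So the sets of possible segments determine \<open>F\<close>, and
  counting gives \<open>k\<^sup>2 \<le> k (2 p q + p + q) + p + q + 1\<close> for \<open>p = |X|\<close>, \<open>q = |Y|\<close>. As
  \<open>4 p q \<le> (p + q)\<^sup>2\<close>, this forces \<open>p + q \<ge> sqrt k\<close> for large \<open>k\<close>, and the sets \<open>X \<union> Y\<close>
  for the \<open>k\<^sup>2\<close> pairs \<open>(a, b)\<close> are disjoint.
\<close>

section \<open>Computations as reachability\<close>

lemma rtranclp_iff_successively:
  "R\<^sup>*\<^sup>* s t \<longleftrightarrow> (\<exists>c. c \<noteq> [] \<and> hd c = s \<and> last c = t \<and> successively R c)"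
proof
  assume "R\<^sup>*\<^sup>* s t"
  then show "\<exists>c. c \<noteq> [] \<and> hd c = s \<and> last c = t \<and> successively R c"
  proof (induction rule: rtranclp_induct)
    case base
    show ?case by (rule exI[of _ "[s]"]) simp
  next
    case (step u v)
    then obtain c where "c \<noteq> [] \<and> hd c = s \<and> last c = u \<and> successively R c" by blast
    with step.hyps(2) show ?case
      by (intro exI[of _ "c @ [v]"]) (simp add: successively_append_iff)
  qed
next
  assume "\<exists>c. c \<noteq> [] \<and> hd c = s \<and> last c = t \<and> successively R c"
  then obtain c where "c \<noteq> []" "hd c = s" "last c = t" "successively R c" by blast
  then show "R\<^sup>*\<^sup>* s t"
  proof (induction c arbitrary: s rule: induct_list012)
    case (3 u v c)
    then show ?case by (auto intro: converse_rtranclp_into_rtranclp)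
  qed auto
qed

text \<open>Correctness constrains only the last state of a finite computation, and a dead end
  aborts exactly when it is nonfinal. Lists of states can therefore give way to
  reachability.\<close>

lemma nbp_computes_iff:
  "nbp_computes k V R g P \<longleftrightarrow>
     nbp_wf k V R P \<and>
     (\<forall>x \<in> V \<rightarrow>\<^sub>E {1..k}.
        (\<forall>q. (activated P x)\<^sup>*\<^sup>* (start P) q \<and> (\<nexists>r. activated P x q r) \<longrightarrow>
           q = final P (g x) \<or> q \<notin> final P ` R) \<and>
        (\<exists>q \<in> final P ` R. (activated P x)\<^sup>*\<^sup>* (start P) q \<and> (\<nexists>r. activated P x q r)))"
proof -
  have "(\<forall>c. finite_computation P x c \<longrightarrow> last c = f \<or> aborts R P x c) \<longleftrightarrow>
      (\<forall>q. (activated P x)\<^sup>*\<^sup>* (start P) q \<and> (\<nexists>r. activated P x q r) \<longrightarrow>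
        q = f \<or> q \<notin> final P ` R)" for x f
    unfolding finite_computation_def aborts_def rtranclp_iff_successively activated_def[symmetric]
    by fast
  moreover have "(\<exists>c. finite_computation P x c \<and> last c \<in> final P ` R) \<longleftrightarrow>
      (\<exists>q \<in> final P ` R. (activated P x)\<^sup>*\<^sup>* (start P) q \<and> (\<nexists>r. activated P x q r))" for x
    unfolding finite_computation_def rtranclp_iff_successively by metis
  ultimately show ?thesis by (simp only: nbp_computes_def)
qed

lemma activatedD:
  assumes "nbp_wf k V R P" "activated P x p q"
  shows "p \<in> states P - final P ` R"
  using bspec[OF assms(1)[unfolded nbp_wf_def, THEN conjunct2, THEN conjunct2, THEN conjunct2,
      THEN conjunct2, THEN conjunct2] assms(2)[unfolded activated_def]]
  by simp

text \<open>Final states have no outgoing edges, so every path to one is a finite computation and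
  must end at the correct label; injectivity of \<open>final P\<close> on \<open>R\<close>
  identifies that label.\<close>

lemma reaches_final_iff:
  assumes P: "nbp_computes k V R g P" and x: "x \<in> V \<rightarrow>\<^sub>E {1..k}" and r: "r \<in> R" "g x \<in> R"
  shows "(activated P x)\<^sup>*\<^sup>* (start P) (final P r) \<longleftrightarrow> g x = r"
proof -
  have wf: "nbp_wf k V R P" using P by (simp add: nbp_computes_def)
  then have inj: "inj_on (final P) R" by (simp add: nbp_wf_def)
  have stuck: "\<nexists>q. activated P x (final P r) q"
    using activatedD[OF wf] r by blast
  note * = P[unfolded nbp_computes_iff, THEN conjunct2, rule_format, OF x]
  show ?thesis
    using * stuck inj_onD[OF inj _ r] r by (metis imageI)
qed

subsection \<open>Existence of a program\<close>

text \<open>Ensures that the minimum defining \<open>ndetBstates\<close> is attained. The witness is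
  the full decision tree that queries the variables in a fixed order.\<close>

lemma nbp_exists:
  fixes V :: "'v set" and g :: "('v \<Rightarrow> nat) \<Rightarrow> 'r::finite"
  assumes "finite V"
  shows "\<exists>P :: (nat, 'v, 'r) nbp. nbp_computes k V UNIV g P"
proof -
  obtain vs where vs: "set vs = V" using assms finite_list by blast
  define m where "m = length vs"
  define D where "D = V \<rightarrow>\<^sub>E {1..k}"
  define L where "L = {l :: nat list. set l \<subseteq> {1..k} \<and> length l \<le> m}"
  have inj: "inj_on (\<lambda>x. map x vs) D"
    unfolding D_def by (intro inj_onI PiE_ext) (auto simp: vs)
  \<comment> \<open>Lists shorter than \<open>m\<close> are inner nodes of the decision tree; lists
    of length \<open>m\<close> collapse to final states. As \<open>vs\<close> may repeat variables,
    some of the latter come from no input; \<open>inv_into\<close> is arbitrary there, but no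
    computation follows such a list.\<close>
  define node :: "nat list \<Rightarrow> nat" where "node l =
    to_nat (if length l = m then Inr (g (inv_into D (\<lambda>x. map x vs) l)) else Inl l)" for l
  define ed where "ed = {(node l, a, node (l @ [a])) | l a. l \<in> L \<and> length l < m \<and> a \<in> {1..k}}"
  define fin :: "'r \<Rightarrow> nat" where "fin r = to_nat (Inr r :: nat list + 'r)" for r
  define P :: "(nat, 'v, 'r) nbp" where "P =
    \<lparr>states = node ` L \<union> range fin, start = node [],
     query = (\<lambda>q. vs ! length (projl (from_nat q :: nat list + 'r))),
     final = fin, edges = mset_set ed\<rparr>"
  have finL: "finite L" unfolding L_def using finite_lists_length_le by blast
  have ed_eq: "ed = (\<lambda>(l, a). (node l, a, node (l @ [a]))) ` ({l \<in> L. length l < m} \<times> {1..k})"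
    unfolding ed_def by auto
  have edges: "set_mset (edges P) = ed"
    using finL by (simp add: P_def ed_eq)
  have node_query: "query P (node l) = vs ! length l" if "length l < m" for l
    using that by (simp add: P_def node_def)
  have node_eq: "node l = node l' \<longleftrightarrow> l = l'" if "length l < m" for l l'
    using that by (auto simp: node_def)
  have node_fin: "node l \<noteq> fin r" if "length l < m" for l r
    using that by (simp add: node_def fin_def)
  have node_fin': "node l \<in> range fin" if "length l = m" for l
    using that by (simp add: node_def fin_def)
  have L_step: "l @ [a] \<in> L" if "l \<in> L" "length l < m" "a \<in> {1..k}" for l a
    using that by (auto simp: L_def)
  have wf: "nbp_wf k V UNIV P"
    unfolding nbp_wf_def
  proof (intro conjI)
    show "finite (states P)" using finL by (simp add: P_def)
    show "start P \<in> states P" by (simp add: P_def L_def)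
    show "inj_on (final P) UNIV" by (simp add: P_def fin_def inj_on_def)
    show "final P ` UNIV \<subseteq> states P" by (simp add: P_def)
    show "\<forall>q\<in>states P - final P ` UNIV. query P q \<in> V"
    proof
      fix q assume "q \<in> states P - final P ` UNIV"
      then obtain l where l: "q = node l" "l \<in> L" "node l \<notin> range fin" by (auto simp: P_def)
      then have "length l < m" using node_fin'[of l] by (force simp: L_def)
      then show "query P q \<in> V" using l vs by (auto simp: node_query m_def)
    qed
    show "\<forall>(p, a, q)\<in>set_mset (edges P). p \<in> states P - final P ` UNIV \<and> a \<in> {1..k} \<and> q \<in> states P"
      unfolding edges ed_def using node_fin L_step by (auto simp: P_def)
  qed
  have "(\<forall>q. (activated P x)\<^sup>*\<^sup>* (start P) q \<and> (\<nexists>r. activated P x q r) \<longrightarrow>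
           q = final P (g x) \<or> q \<notin> range (final P)) \<and>
        (\<exists>q \<in> range (final P). (activated P x)\<^sup>*\<^sup>* (start P) q \<and> (\<nexists>r. activated P x q r))"
    if x: "x \<in> D" for x
  proof -
    \<comment> \<open>The states of the only computation on \<open>x\<close>, since the program is
      deterministic.\<close>
    define w where "w i = node (take i (map x vs))" for i
    have xV: "x v \<in> {1..k}" if "v \<in> set vs" for v
      using x that vs by (auto simp: D_def)
    have pre: "take i (map x vs) \<in> L" for i
      using xV set_take_subset[of i "map x vs"] by (fastforce simp: L_def m_def)
    have act: "activated P x (w i) q \<longleftrightarrow> q = w (Suc i)" if "i < m" for i q
    proof -
      have i: "length (take i (map x vs)) = i" using that by (simp add: m_def)
      have val: "x (query P (w i)) = x (vs ! i)" using that node_query i by (simp add: w_def)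
      have "x (vs ! i) \<in> {1..k}" using xV that by (simp add: m_def)
      moreover have "take (Suc i) (map x vs) = take i (map x vs) @ [x (vs ! i)]"
        using that by (simp add: m_def take_Suc_conv_app_nth)
      ultimately show ?thesis
        unfolding activated_def edges val ed_def using that pre[of i] i node_eq
        by (auto simp: w_def)
    qed
    have wm: "w m = final P (g x)"
      by (simp add: w_def node_def m_def P_def fin_def inv_into_f_f[OF inj x])
    have stuck: "\<nexists>r. activated P x (w m) r"
      using activatedD[OF wf] wm by blast
    have reach: "(activated P x)\<^sup>*\<^sup>* (start P) (w i)" if "i \<le> m" for i
      using that
    proof (induction i)
      case 0
      show ?case by (simp add: w_def P_def)
    next
      case (Suc i)
      then show ?case using act[of i "w (Suc i)"] by (simp add: rtranclp.rtrancl_into_rtrancl)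
    qed
    have only: "\<exists>i\<le>m. q = w i" if "(activated P x)\<^sup>*\<^sup>* (start P) q" for q
      using that
    proof (induction rule: rtranclp_induct)
      case base
      show ?case by (rule exI[of _ 0]) (simp add: w_def P_def)
    next
      case (step p q)
      then obtain i where i: "i \<le> m" "p = w i" by blast
      with step.hyps(2) stuck have "i < m" by (metis le_neq_implies_less)
      with step.hyps(2) i act show ?case by (metis Suc_leI)
    qed
    show ?thesis
    proof (intro conjI allI impI)
      fix q assume "(activated P x)\<^sup>*\<^sup>* (start P) q \<and> (\<nexists>r. activated P x q r)"
      then show "q = final P (g x) \<or> q \<notin> range (final P)"
        using only act wm by (metis le_neq_implies_less)
    qed (use reach[of m] wm stuck in auto)
  qed
  with wf have "nbp_computes k V UNIV g P"
    unfolding nbp_computes_iff by (simp add: D_def)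
  then show ?thesis by blast
qed

subsection \<open>Segments of paths\<close>

text \<open>Only the source of a step is restricted, so a segment may end in \<open>Z\<close>:
  entering a state does not yet read its variable.\<close>

definition leaving_outside :: "'q set \<Rightarrow> ('q \<Rightarrow> 'q \<Rightarrow> bool) \<Rightarrow> 'q \<Rightarrow> 'q \<Rightarrow> bool" where
  "leaving_outside Z E u v \<longleftrightarrow> u \<notin> Z \<and> E u v"

text \<open>A path is cut only where it switches between leaving \<open>X\<close> and leaving
  \<open>Y\<close>. Cutting at every visit to \<open>X \<union> Y\<close> would also need segments
  within \<open>X\<close> and within \<open>Y\<close>, giving about \<open>(p + q)\<^sup>2\<close>
  endpoint pairs in place of \<open>2 * p * q\<close>; the factor saved later absorbs the
  lower-order terms.\<close>

lemma reaches_if_segments: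
  assumes disj: "X \<inter> Y = {}"
    and S: "\<And>v. v \<in> insert t (X \<union> Y) \<Longrightarrow> (leaving_outside (X \<union> Y) E)\<^sup>*\<^sup>* s v \<Longrightarrow> E'\<^sup>*\<^sup>* s v"
    and X: "\<And>u v. u \<in> X \<Longrightarrow> v \<in> insert t Y \<Longrightarrow> (leaving_outside Y E)\<^sup>*\<^sup>* u v \<Longrightarrow> E'\<^sup>*\<^sup>* u v"
    and Y: "\<And>u v. u \<in> Y \<Longrightarrow> v \<in> insert t X \<Longrightarrow> (leaving_outside X E)\<^sup>*\<^sup>* u v \<Longrightarrow> E'\<^sup>*\<^sup>* u v"
    and reach: "E\<^sup>*\<^sup>* s t"
  shows "E'\<^sup>*\<^sup>* s t"
proof -
  \<comment> \<open>The unfinished last segment of an \<open>E\<close>-path, whose completed segments lie in \<open>E'\<close>.\<close>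
  define Seg where "Seg v \<longleftrightarrow> (leaving_outside (X \<union> Y) E)\<^sup>*\<^sup>* s v \<or>
    (\<exists>u\<in>X. E'\<^sup>*\<^sup>* s u \<and> (leaving_outside Y E)\<^sup>*\<^sup>* u v) \<or>
    (\<exists>u\<in>Y. E'\<^sup>*\<^sup>* s u \<and> (leaving_outside X E)\<^sup>*\<^sup>* u v)" for v
  have "Seg t"
    using reach
  proof (induction rule: rtranclp_induct)
    case base
    show ?case by (simp add: Seg_def)
  next
    case (step v w)
    consider "v \<in> X" | "v \<in> Y" | "v \<notin> X \<union> Y" by blast
    then show ?case
    proof cases
      case 1
      then have e: "leaving_outside Y E v w" using disj step.hyps(2)
        by (auto simp: leaving_outside_def)
      \<comment> \<open>Arriving in \<open>X\<close> completes a segment begun at \<open>s\<close>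
        or in \<open>Y\<close>, and a new one starts at \<open>v\<close>; a segment begun in
        \<open>X\<close> simply continues.\<close>
      from step.IH 1 S Y have "E'\<^sup>*\<^sup>* s v \<or> (\<exists>u\<in>X. E'\<^sup>*\<^sup>* s u \<and> (leaving_outside Y E)\<^sup>*\<^sup>* u v)"
        unfolding Seg_def by (meson UnI1 insertI2 rtranclp_trans)
      with e 1 show ?thesis unfolding Seg_def
        by (meson r_into_rtranclp rtranclp.rtrancl_into_rtrancl)
    next
      case 2
      then have e: "leaving_outside X E v w" using disj step.hyps(2)
        by (auto simp: leaving_outside_def)
      from step.IH 2 S X have "E'\<^sup>*\<^sup>* s v \<or> (\<exists>u\<in>Y. E'\<^sup>*\<^sup>* s u \<and> (leaving_outside X E)\<^sup>*\<^sup>* u v)"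
        unfolding Seg_def by (meson UnI2 insertI2 rtranclp_trans)
      with e 2 show ?thesis unfolding Seg_def
        by (meson r_into_rtranclp rtranclp.rtrancl_into_rtrancl)
    next
      case 3
      then have "leaving_outside X E v w" "leaving_outside Y E v w"
        "leaving_outside (X \<union> Y) E v w"
        using step.hyps(2) by (auto simp: leaving_outside_def)
      with step.IH show ?thesis unfolding Seg_def
        by (meson rtranclp.rtrancl_into_rtrancl)
    qed
  qed
  then show ?thesis
    unfolding Seg_def using S X Y by (meson insertI1 rtranclp_trans)
qed

definition querying :: "'r set \<Rightarrow> ('q, 'v, 'r) nbp \<Rightarrow> 'v \<Rightarrow> 'q set" where
  "querying R P v = {q \<in> states P - final P ` R. query P q = v}"

text \<open>Whether an edge is activated depends only on the variable queried at its source.\<close>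

lemma leaving_outside_querying_cong:
  assumes "nbp_wf k V R P" "\<And>v. v \<notin> W \<Longrightarrow> x v = y v" "Z = (\<Union>v\<in>W. querying R P v)"
  shows "leaving_outside Z (activated P x) = leaving_outside Z (activated P y)"
proof (intro ext)
  fix p q
  have "x (query P p) = y (query P p)" if "p \<in> states P - final P ` R" "p \<notin> Z"
    using that assms(2)[of "query P p"] by (auto simp: querying_def assms(3))
  then show "leaving_outside Z (activated P x) p q = leaving_outside Z (activated P y) p q"
    using activatedD[OF assms(1)] by (fastforce simp: leaving_outside_def activated_def)
qed

subsection \<open>Counting\<close>

text \<open>The value \<open>2\<close> stands for rejection, which is why \<open>2 \<le> k\<close>
  is assumed later. Even leaves are left children, so nodes 2 and 3 are both evaluated at
  \<open>(a, b)\<close>.\<close>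

definition tree_input :: "nat \<Rightarrow> nat \<Rightarrow> nat \<Rightarrow> (nat \<times> nat) set \<Rightarrow> nat \<Rightarrow> nat \<Rightarrow> bt_var \<Rightarrow> nat" where
  "tree_input k a b F c d = (\<lambda>v\<in>bt_vars k. case v of
       Fn i u w \<Rightarrow> if i = 1 then (if (u, w) \<in> F then 1 else 2)
                   else if (i, u, w) = (2, a, b) then c
                   else if (i, u, w) = (3, a, b) then d else 1
     | Leaf j \<Rightarrow> if even j then a else b)"

lemma tree_input_in:
  assumes "2 \<le> k" "a \<in> {1..k}" "b \<in> {1..k}" "c \<in> {1..k}" "d \<in> {1..k}"
  shows "tree_input k a b F c d \<in> bt_vars k \<rightarrow>\<^sub>E {1..k}"
proof (rule PiE_I)
  show "tree_input k a b F c d v \<in> {1..k}" if "v \<in> bt_vars k" for v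
    using assms that by (cases v) (simp_all add: tree_input_def)
qed (simp add: tree_input_def)

lemma BT_tree_input:
  assumes "a \<in> {1..k}" "b \<in> {1..k}" "c \<in> {1..k}" "d \<in> {1..k}"
  shows "BT (tree_input k a b F c d) \<longleftrightarrow> (c, d) \<in> F"
proof -
  let ?x = "tree_input k a b F c d"
  have leaf: "node_value ?x 4 = a" "node_value ?x 5 = b" "node_value ?x 6 = a" "node_value ?x 7 = b"
    by (simp_all add: node_value.simps tree_input_def bt_vars_def)
  have "node_value ?x 2 = c"
    using assms leaf by (subst node_value.simps) (simp add: tree_input_def bt_vars_def)
  moreover have "node_value ?x 3 = d"
    using assms leaf by (subst node_value.simps) (simp add: tree_input_def bt_vars_def)
  ultimately show ?thesis
    using assms unfolding BT_def
    by (subst node_value.simps) (simp add: tree_input_def bt_vars_def numeral_2_eq_2[symmetric])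
qed

lemma tree_input_eq:
  "v \<noteq> Fn 2 a b \<Longrightarrow> v \<notin> {Fn 3 a b} \<Longrightarrow> tree_input k a b F c d v = tree_input k a b F c' d' v"
  "v \<notin> {Fn 3 a b} \<Longrightarrow> tree_input k a b F c d v = tree_input k a b F c d' v"
  "v \<notin> {Fn 2 a b} \<Longrightarrow> tree_input k a b F c d v = tree_input k a b F c' d v"
  by (cases v; auto simp: tree_input_def)+

lemma querying_count:
  fixes P :: "('q, bt_var, bool) nbp"
  assumes P: "nbp_computes k (bt_vars k) UNIV BT P"
    and k: "2 \<le> k" and ab: "a \<in> {1..k}" "b \<in> {1..k}"
  defines "p \<equiv> card (querying UNIV P (Fn 2 a b))" and "q \<equiv> card (querying UNIV P (Fn 3 a b))"
  shows "k * k \<le> k * (2 * p * q + p + q) + p + q + 1"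
proof -
  have wf: "nbp_wf k (bt_vars k) UNIV P" using P by (simp add: nbp_computes_def)
  define X where "X = querying UNIV P (Fn 2 a b)"
  define Y where "Y = querying UNIV P (Fn 3 a b)"
  define T where "T = final P True"
  define E where "E F c d = activated P (tree_input k a b F c d)" for F c d
  have fin: "finite X" "finite Y" using wf by (auto simp: X_def Y_def querying_def nbp_wf_def)
  have disj: "X \<inter> Y = {}" by (auto simp: X_def Y_def querying_def)
  have T: "T \<notin> X" "T \<notin> Y" by (auto simp: X_def Y_def T_def querying_def)
  \<comment> \<open>The \<open>1\<close> is a placeholder: without leaving \<open>Y\<close>, the
    value of \<open>Fn 3 a b\<close> is never read.\<close>
  have EX: "leaving_outside Y (E F c d) = leaving_outside Y (E F c 1)" for F c d
    unfolding E_def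
    by (rule leaving_outside_querying_cong[OF wf, of "{Fn 3 a b}"])
       (auto simp: Y_def intro: tree_input_eq)
  have EY: "leaving_outside X (E F c d) = leaving_outside X (E F 1 d)" for F c d
    unfolding E_def
    by (rule leaving_outside_querying_cong[OF wf, of "{Fn 2 a b}"])
       (auto simp: X_def intro: tree_input_eq)
  have ES: "leaving_outside (X \<union> Y) (E F c d) = leaving_outside (X \<union> Y) (E F 1 1)" for F c d
    unfolding E_def
    by (rule leaving_outside_querying_cong[OF wf, of "{Fn 2 a b, Fn 3 a b}"])
       (auto simp: X_def Y_def intro: tree_input_eq)
  define A where "A F = {(u, c, v) \<in> X \<times> {1..k} \<times> insert T Y. (leaving_outside Y (E F c 1))\<^sup>*\<^sup>* u v}" for F
  define B where "B F = {(u, d, v) \<in> Y \<times> {1..k} \<times> insert T X. (leaving_outside X (E F 1 d))\<^sup>*\<^sup>* u v}" for F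
  define C where "C F = {v \<in> insert T (X \<union> Y). (leaving_outside (X \<union> Y) (E F 1 1))\<^sup>*\<^sup>* (start P) v}" for F
  have mono: "R\<^sup>*\<^sup>* u v" if "(leaving_outside Z R)\<^sup>*\<^sup>* u v" for Z R and u v :: 'q
    using that by (rule rtranclp_mono[THEN predicate2D, rotated]) (auto simp: leaving_outside_def)
  have sub: "F \<subseteq> G"
    \<comment> \<open>An accepting path for \<open>F\<close> is reassembled from segments available
      for \<open>G\<close>. Nondeterminism makes this one-sided transfer enough; equality of
      \<open>F\<close> and \<open>G\<close> follows by symmetry.\<close>
    if FG: "A F = A G" "B F = B G" "C F = C G" and F: "F \<subseteq> {1..k} \<times> {1..k}" for F G
  proof clarify
    fix c d assume cd: "(c, d) \<in> F"
    with F have cd': "c \<in> {1..k}" "d \<in> {1..k}" by auto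
    note in_k = tree_input_in[OF k ab cd']
    have acc: "(E H c d)\<^sup>*\<^sup>* (start P) T \<longleftrightarrow> (c, d) \<in> H" for H
      using reaches_final_iff[OF P in_k, of True H] BT_tree_input[OF ab cd', of H]
      by (simp add: E_def T_def)
    have "(E G c d)\<^sup>*\<^sup>* (start P) T"
    proof (rule reaches_if_segments[OF disj])
      show "(E F c d)\<^sup>*\<^sup>* (start P) T" using acc cd by blast
      fix v assume "v \<in> insert T (X \<union> Y)" "(leaving_outside (X \<union> Y) (E F c d))\<^sup>*\<^sup>* (start P) v"
      then have "v \<in> C F" using ES[of F c d] by (auto simp: C_def)
      then have "v \<in> C G" using FG by simp
      then show "(E G c d)\<^sup>*\<^sup>* (start P) v" using ES[of G c d] mono[of "X \<union> Y"] by (simp add: C_def)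
    next
      fix u v assume "u \<in> X" "v \<in> insert T Y" "(leaving_outside Y (E F c d))\<^sup>*\<^sup>* u v"
      then have "(u, c, v) \<in> A F" using EX[of F c d] cd' by (auto simp: A_def)
      then have "(u, c, v) \<in> A G" using FG by simp
      then show "(E G c d)\<^sup>*\<^sup>* u v" using EX[of G c d] mono[of Y] by (simp add: A_def)
    next
      fix u v assume "u \<in> Y" "v \<in> insert T X" "(leaving_outside X (E F c d))\<^sup>*\<^sup>* u v"
      then have "(u, d, v) \<in> B F" using EY[of F c d] cd' by (auto simp: B_def)
      then have "(u, d, v) \<in> B G" using FG by simp
      then show "(E G c d)\<^sup>*\<^sup>* u v" using EY[of G c d] mono[of X] by (simp add: B_def)
    qed
    then show "(c, d) \<in> G" using acc by blast
  qed
  have "inj_on (\<lambda>F. (A F, B F, C F)) (Pow ({1..k} \<times> {1..k}))"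
  proof (rule inj_onI)
    fix F G
    assume "F \<in> Pow ({1..k} \<times> {1..k})" "G \<in> Pow ({1..k} \<times> {1..k})"
      and "(A F, B F, C F) = (A G, B G, C G)"
    then show "F = G" using sub[of F G] sub[of G F] by simp
  qed
  moreover have "(\<lambda>F. (A F, B F, C F)) ` Pow ({1..k} \<times> {1..k}) \<subseteq>
    Pow (X \<times> {1..k} \<times> insert T Y) \<times> Pow (Y \<times> {1..k} \<times> insert T X) \<times> Pow (insert T (X \<union> Y))"
    by (auto simp: A_def B_def C_def)
  ultimately have "card (Pow ({1..k} \<times> {1..k})) \<le>
    card (Pow (X \<times> {1..k} \<times> insert T Y) \<times> Pow (Y \<times> {1..k} \<times> insert T X) \<times> Pow (insert T (X \<union> Y)))"
    using fin by (intro card_inj_on_le) auto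
  \<comment> \<open>\<open>T\<close> lies outside \<open>X\<close> and \<open>Y\<close>, so the
    target sets have \<open>q + 1\<close>, \<open>p + 1\<close> and \<open>p + q + 1\<close>
    elements.\<close>
  then have "(2::nat) ^ (k * k) \<le> 2 ^ (p * (k * (q + 1)) + q * (k * (p + 1)) + (p + q + 1))"
    using fin disj T
    by (simp add: card_cartesian_product card_Pow card_Un_disjoint p_def q_def X_def[symmetric]
        Y_def[symmetric] power_add mult.assoc)
  then have "k * k \<le> p * (k * (q + 1)) + q * (k * (p + 1)) + (p + q + 1)"
    by (rule power_le_imp_le_exp[rotated]) simp
  then show ?thesis by (simp add: algebra_simps)
qed

section \<open>From the counting inequality to the number of states\<close>

text \<open>If \<open>p + q < r\<close> with \<open>r = sqrt k\<close>, then
  \<open>2 * p * q\<close> is at most half of \<open>r\<^sup>2\<close>, so the right-hand side has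
  leading term only half of \<open>r ^ 4\<close>. The threshold 100 means \<open>r \<ge> 10\<close>,
  ample for the remaining terms.\<close>

lemma sqrt_le_if_count:
  fixes k p q :: nat
  assumes count: "k * k \<le> k * (2 * p * q + p + q) + p + q + 1" and k: "100 \<le> k"
  shows "sqrt (real k) \<le> real (p + q)"
proof (rule ccontr)
  define r where "r = sqrt (real k)"
  define s where "s = real (p + q)"
  assume "\<not> ?thesis"
  then have sr: "s < r" by (simp add: r_def s_def)
  have r: "real k = r\<^sup>2" by (simp add: r_def)
  have r10: "10 \<le> r" unfolding r_def using k by (intro real_le_rsqrt) simp
  have "0 \<le> s" by (simp add: s_def)
  then have "s\<^sup>2 \<le> r\<^sup>2" using sr by (intro power_mono) auto
  have "4 * (real p * real q) \<le> s\<^sup>2"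
    using sum_squares_ge_zero[of "real p - real q" 0] by (simp add: s_def power2_eq_square algebra_simps)
  then have pq: "2 * real p * real q + s \<le> r\<^sup>2 / 2 + r"
    using \<open>s\<^sup>2 \<le> r\<^sup>2\<close> sr by simp
  have "real (k * k) \<le> real (k * (2 * p * q + p + q) + p + q + 1)"
    using count by (simp only: of_nat_le_iff)
  then have "r\<^sup>2 * r\<^sup>2 \<le> r\<^sup>2 * (2 * real p * real q + s) + s + 1"
    by (simp add: r s_def algebra_simps)
  also have "\<dots> \<le> r\<^sup>2 * (r\<^sup>2 / 2 + r) + r + 1"
    using mult_left_mono[OF pq, of "r\<^sup>2"] sr by simp
  finally have "r\<^sup>2 * r\<^sup>2 \<le> 2 * (r\<^sup>2 * r) + 2 * r + 2" by (simp add: algebra_simps)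
  moreover have "10 * (r\<^sup>2 * r) \<le> r\<^sup>2 * r\<^sup>2"
    using mult_mono[OF r10 order_refl, of "r\<^sup>2 * r"] r10 by (simp add: power2_eq_square ac_simps)
  moreover have "r \<le> r\<^sup>2 * r" using r10 one_le_power[of r 2] by simp
  ultimately show False using r10 by linarith
qed

lemma card_states_ge:
  fixes P :: "('q, bt_var, bool) nbp"
  assumes P: "nbp_computes k (bt_vars k) UNIV BT P" and k: "100 \<le> k"
  shows "real k powr (5 / 2) \<le> real (card (states P))"
proof -
  have fin: "finite (states P)" using P by (simp add: nbp_computes_def nbp_wf_def)
  define S where "S ab = querying UNIV P (Fn 2 (fst ab) (snd ab)) \<union>
    querying UNIV P (Fn 3 (fst ab) (snd ab))" for ab
  have S: "sqrt (real k) \<le> real (card (S ab))" if ab: "ab \<in> {1..k} \<times> {1..k}" for ab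
  proof -
    have "card (S ab) = card (querying UNIV P (Fn 2 (fst ab) (snd ab))) +
        card (querying UNIV P (Fn 3 (fst ab) (snd ab)))"
      unfolding S_def using fin by (intro card_Un_disjoint) (auto simp: querying_def)
    then show ?thesis
      using sqrt_le_if_count[OF querying_count[OF P, of "fst ab" "snd ab"] k] ab k by auto
  qed
  have "real k powr (5 / 2) = real k powr (2 + 1 / 2)" by simp
  also have "\<dots> = real k ^ 2 * sqrt (real k)"
    using k by (subst powr_add) (simp add: powr_half_sqrt powr_numeral)
  also have "\<dots> = (\<Sum>ab\<in>{1..k} \<times> {1..k}. sqrt (real k))"
    by (simp add: card_cartesian_product power2_eq_square)
  also have "\<dots> \<le> (\<Sum>ab\<in>{1..k} \<times> {1..k}. real (card (S ab)))"
    by (intro sum_mono S)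
  \<comment> \<open>Disjointness holds because each state queries a single variable.\<close>
  also have "\<dots> = real (card (\<Union>ab\<in>{1..k} \<times> {1..k}. S ab))"
    using fin by (subst card_UN_disjoint) (auto simp: S_def querying_def)
  also have "\<dots> \<le> real (card (states P))"
    using fin by (intro of_nat_mono card_mono) (auto simp: S_def querying_def)
  finally show ?thesis .
qed

lemma finite_bt_vars: "finite (bt_vars k)"
proof -
  have "bt_vars k = (\<Union>i\<in>{1..3}. \<Union>a\<in>{1..k}. Fn i a ` {1..k}) \<union> Leaf ` {4..7}"
    unfolding bt_vars_def by blast
  then show ?thesis by simp
qed

theorem theorem5p6:
  "\<exists>k0. \<forall>k \<ge> k0. real (ndetBstates k) \<ge> real k powr (5 / 2)"
proof (intro exI allI impI)
  fix k :: nat assume k: "100 \<le> k"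
  have "\<exists>n. \<exists>P :: (nat, bt_var, bool) nbp. nbp_computes k (bt_vars k) UNIV BT P \<and> card (states P) = n"
    using nbp_exists[OF finite_bt_vars] by blast
  then have "\<exists>P :: (nat, bt_var, bool) nbp.
      nbp_computes k (bt_vars k) UNIV BT P \<and> card (states P) = ndetBstates k"
    unfolding ndetBstates_def by (rule LeastI_ex)
  then show "real (ndetBstates k) \<ge> real k powr (5 / 2)"
    using card_states_ge[OF _ k] by metis
qed

end
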